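(* Let $v\in\mathbb R^2\setminus\{0\}$ be a point of irrational slope, let $T>0$ be real, and let $w\in\mathbb R^2\setminus\{0\}$ be a point of rational slope. Then the distance from $\Gamma_T v=\{\gamma v : \gamma\in\Gamma_T\}$ to $w$ is bounded from below by $$\frac{\mathcal D_v(\rho(w))}{T}=\frac{\mathcal D_v\!\left(\frac{h(w)^2}{|w|^2}\right)}{T},$$ i.e. $|\gamma v-w|\ge \frac{\mathcal D_v(\rho(w))}{T}$ for every $\gamma\in\Gamma_T$.
   Context: $|\cdot|$ is the euclidean norm on $\mathbb R^2$, $d$ the euclidean distance, and $\|\cdot\|$ the euclidean norm on real $2\times 2$ matrices (square root of the sum of squares of the entries). For $T>0$, $\Gamma_T=\{\gamma\in \mathrm{SL}(2,\mathbb Z) : \|\gamma\|\le T\}$. A point $\binom{a}{b}\in\mathbb R^2\setminus\{0\}$ has rational slope if $a=0$ or $b/a\in\mathbb Q$; otherwise it has irrational slope. A point $w$ of rational slope can be written $w=t\binom{p}{q}$ with $t\in\mathbb R\setminus\{0\}$ and $p,q$ coprime integers; its height is $h(w)=\sqrt{p^2+q^2}$. The period $\rho(w)$ of a point $w$ of rational slope is the period of the map $\mathbb R\to \mathrm{SL}(2,\mathbb Z)\backslash \mathrm{SL}(2,\mathbb R)$, $s\mapsto \mathrm{SL}(2,\mathbb Z)\,g\,u(s)$, where $u(s)=\begin{pmatrix}1&s\\0&1\end{pmatrix}$ and $g\in \mathrm{SL}(2,\mathbb R)$ is any matrix with first column $w$; that is, the smallest $s>0$ such that $\gamma g=g\,u(s)$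 for some $\gamma\in \mathrm{SL}(2,\mathbb Z)$ (it does not depend on $g$). If $w=t\binom pq$ with $t\in\mathbb R\setminus\{0\}$ and $p,q$ coprime integers, then $\rho(w)=1/t^2$. For $\rho>0$, $\mathcal P(\rho)$ is the set of points of $\mathbb R^2\setminus\{0\}$ of rational slope and period $\rho$; equivalently $\mathcal P(\rho)=\frac{1}{\sqrt\rho}\{\binom pq\in\mathbb Z^2 : \gcd(p,q)=1\}$. For $v$ of irrational slope, the spectrum of periods of $v$ is the function $\mathcal D_v:(0,\infty)\to(0,\infty)$, $\mathcal D_v(\rho)=d(v,\mathcal P(\rho))$. *)

theory Defs
  imports "HOL-Analysis.Analysis"
begin

definition SL2R :: "(real^2^2) set" where
  "SL2R = {g. det g = 1}"

definition SL2Z :: "(real^2^2) set" where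
  "SL2Z = {g \<in> SL2R. \<forall>i j. g $ i $ j \<in> \<int>}"

text \<open>The norm of the type \<^typ>\<open>real^2^2\<close> is the square root of the sum of the squares
  of the entries (not the operator norm).\<close>

definition Gamma_ball :: "real \<Rightarrow> (real^2^2) set" where
  "Gamma_ball T = {\<gamma> \<in> SL2Z. norm \<gamma> \<le> T}"

definition unip :: "real \<Rightarrow> real^2^2" where
  "unip s = vector [vector [1, s], vector [0, 1]]"

text \<open>The two slope predicates are meant for nonzero points; the origin satisfies
  \<open>rational_slope\<close>.\<close>

definition rational_slope :: "real^2 \<Rightarrow> bool" where
  "rational_slope w \<longleftrightarrow> w $ 1 = 0 \<or> w $ 2 / w $ 1 \<in> \<rat>"

definition irrational_slope :: "real^2 \<Rightarrow> bool" where
  "irrational_slope v \<longleftrightarrow> \<not> rational_slope v"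

text \<open>For \<open>w \<noteq> 0\<close> of rational slope, the pair \<open>(p, q)\<close> below exists and is unique up to
  a common sign, so the height is determined.\<close>

definition slope_height :: "real^2 \<Rightarrow> real" where
  "slope_height w = (THE h. \<exists>(t::real) (p::int) (q::int).
     t \<noteq> 0 \<and> coprime p q \<and> w = t *\<^sub>R vector [of_int p, of_int q] \<and>
     h = sqrt ((of_int p)\<^sup>2 + (of_int q)\<^sup>2))"

text \<open>The smallest \<open>s > 0\<close> at which the orbit of the coset of \<open>g\<close> under right
  multiplication by \<open>unip s\<close> returns to its starting point.\<close>

definition horocycle_period :: "real^2^2 \<Rightarrow> real" where
  "horocycle_period g = (LEAST s. s > 0 \<and> (\<exists>\<gamma>\<in>SL2Z. \<gamma> ** g = g ** unip s))"

text \<open>For \<open>w \<noteq> 0\<close> of rational slope, \<open>horocycle_period g\<close> is the same for all \<open>g\<close> with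
  first column \<open>w\<close>.\<close>

definition period :: "real^2 \<Rightarrow> real" where
  "period w = (THE \<rho>. \<forall>g\<in>SL2R. column 1 g = w \<longrightarrow> horocycle_period g = \<rho>)"

definition period_points :: "real \<Rightarrow> (real^2) set" where
  "period_points \<rho> = {w. w \<noteq> 0 \<and> rational_slope w \<and> period w = \<rho>}"

text \<open>Meant for \<open>\<rho> > 0\<close>, where \<open>period_points \<rho>\<close> is nonempty.\<close>

definition period_spectrum :: "real^2 \<Rightarrow> real \<Rightarrow> real" where
  "period_spectrum v \<rho> = infdist v (period_points \<rho>)"

end

theory Submission
  imports Defs
begin

text \<open>
  The set \<open>period_points \<rho>\<close> is invariant under \<open>SL2Z\<close>, and an element \<open>\<gamma>\<close> of \<open>SL2Z\<close> has the
  same norm as its inverse, because the inverse is the adjugate. So for \<open>\<gamma>\<close> of norm at most \<open>T\<close>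
  the point \<open>\<gamma>\<inverse> w\<close> is a competitor in the distance from \<open>v\<close> to \<open>period_points (period w)\<close>, and
  \<open>dist v (\<gamma>\<inverse> w) = norm (\<gamma>\<inverse> (\<gamma> v - w)) \<le> norm \<gamma>\<inverse> * norm (\<gamma> v - w) \<le> T * norm (\<gamma> v - w)\<close>.

  The invariance and the formula in terms of the height both come from the explicit value of the
  period: \<open>t (p, q)\<close> with \<open>p, q\<close> coprime has period \<open>1 / t\<^sup>2\<close> (lemma
  \<open>period_scaled_primitive\<close>). Indeed, if \<open>g\<close> has determinant 1 and first column \<open>(a, c)\<close>, then
  \<open>g (unip s) g\<inverse> = I + s N\<close>, where \<open>N\<close> has rows \<open>(- a c, a\<^sup>2)\<close> and \<open>(- c\<^sup>2, a c)\<close>.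
  For \<open>(a, c) = t (p, q)\<close> this matrix is integral exactly when \<open>s t\<^sup>2\<close> is an integer, since \<open>p\<^sup>2\<close> and \<open>q\<^sup>2\<close> are coprime. On the other
  hand \<open>SL2Z\<close> permutes the primitive integer vectors, so it preserves \<open>\<bar>t\<bar>\<close>.
\<close>

lemmas entrywise_2 = vec_eq_iff forall_2 sum_2 matrix_matrix_mult_def matrix_vector_mult_def
  column_def mat_def vector_2

lemma norm_matrix_vector_mult_le:
  fixes A :: "real^'n^'m"
  shows "norm (A *v x) \<le> norm A * norm x"
proof -
  have "norm (A *v x) = L2_set (\<lambda>i. \<bar>A $ i \<bullet> x\<bar>) UNIV"
    by (simp add: norm_vec_def matrix_vector_mul_component)
  also have "\<dots> \<le> L2_set (\<lambda>i. norm (A $ i) * norm x) UNIV"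
    by (intro L2_set_mono) (simp_all add: Cauchy_Schwarz_ineq2)
  also have "\<dots> = norm A * norm x"
    by (simp add: norm_vec_def[of A] L2_set_left_distrib)
  finally show ?thesis .
qed

text \<open>The witness is the adjugate: its entries are, up to sign and order, those of \<open>\<gamma>\<close>.\<close>

lemma SL2Z_inverse_same_norm:
  assumes "\<gamma> \<in> SL2Z"
  obtains \<delta> where "\<delta> \<in> SL2Z" "\<delta> ** \<gamma> = mat 1" "norm \<delta> = norm \<gamma>"
proof
  define \<delta> :: "real^2^2"
    where "\<delta> = vector [vector [\<gamma>$2$2, - \<gamma>$1$2], vector [- \<gamma>$2$1, \<gamma>$1$1]]"
  have det: "\<gamma>$1$1 * \<gamma>$2$2 - \<gamma>$1$2 * \<gamma>$2$1 = 1"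
    using assms by (simp add: SL2Z_def SL2R_def det_2)
  show "\<delta> \<in> SL2Z"
    using assms det by (simp add: SL2Z_def SL2R_def det_2 \<delta>_def forall_2 algebra_simps)
  show "\<delta> ** \<gamma> = mat 1"
    using det by (simp add: \<delta>_def entrywise_2 algebra_simps)
  show "norm \<delta> = norm \<gamma>"
    by (simp add: \<delta>_def norm_vec_def L2_set_def sum_2 add_ac)
qed

lemma rational_slope_iff_scaled_primitive:
  fixes w :: "real^2"
  assumes "w \<noteq> 0"
  shows "rational_slope w \<longleftrightarrow>
    (\<exists>(t::real) (p::int) (q::int). t \<noteq> 0 \<and> coprime p q \<and> w = t *\<^sub>R vector [of_int p, of_int q])"
    (is "_ \<longleftrightarrow> ?R")
proof
  assume "rational_slope w"
  then consider "w $ 1 = 0" | "w $ 1 \<noteq> 0" "w $ 2 / w $ 1 \<in> \<rat>"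
    by (auto simp: rational_slope_def)
  then show ?R
  proof cases
    case 1
    then have "w $ 2 \<noteq> 0 \<and> coprime (0::int) 1 \<and> w = w $ 2 *\<^sub>R vector [of_int 0, of_int 1]"
      using assms by (simp add: entrywise_2)
    then show ?thesis by blast
  next
    case 2
    obtain m n :: int where mn: "n > 0" "coprime m n" "w $ 2 / w $ 1 = of_int m / of_int n"
      using Rats_cases'[OF 2(2)] by metis
    have "w = (w $ 1 / of_int n) *\<^sub>R vector [of_int n, of_int m]"
      using mn 2(1) by (simp add: entrywise_2 field_simps)
    moreover have "w $ 1 / of_int n \<noteq> 0" "coprime n m"
      using mn 2(1) by (simp_all add: coprime_commute)
    ultimately show ?thesis by blast
  qed
next
  assume ?R
  then show "rational_slope w"
    by (auto simp: rational_slope_def)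
qed

text \<open>The equation forces \<open>\<gamma>\<close> to be the conjugate of \<open>unip s\<close> by \<open>g\<close>, whose entries are
  polynomials in \<open>p, q\<close> and \<open>s t\<^sup>2\<close>; the second column of \<open>g\<close> drops out.\<close>

lemma conjugate_unip_in_SL2Z_iff:
  assumes g: "g \<in> SL2R" and col: "column 1 g = t *\<^sub>R vector [of_int p, of_int q]"
    and cop: "coprime p q"
  shows "(\<exists>\<gamma>\<in>SL2Z. \<gamma> ** g = g ** unip s) \<longleftrightarrow> s * t\<^sup>2 \<in> \<int>"
proof -
  define b d where "b = g$1$2" and "d = g$2$2"
  have a: "g$1$1 = t * of_int p" and c: "g$2$1 = t * of_int q"
    using col by (simp_all add: entrywise_2)
  have det: "t * of_int p * d - b * (t * of_int q) = 1"
    using g a c by (simp add: SL2R_def det_2 b_def d_def)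
  show ?thesis
  proof
    assume "\<exists>\<gamma>\<in>SL2Z. \<gamma> ** g = g ** unip s"
    then obtain \<gamma> where \<gamma>: "\<gamma> \<in> SL2Z" and eq: "\<gamma> ** g = g ** unip s" by blast
    let ?x = "\<gamma>$1$1" and ?y = "\<gamma>$1$2" and ?z = "\<gamma>$2$1" and ?k = "\<gamma>$2$2"
    have e: "?x * (t * of_int p) + ?y * (t * of_int q) = t * of_int p"
      "?x * b + ?y * d = t * of_int p * s + b"
      "?z * (t * of_int p) + ?k * (t * of_int q) = t * of_int q"
      "?z * b + ?k * d = t * of_int q * s + d"
      using eq by (simp_all add: entrywise_2 unip_def a c b_def d_def)
    have "?y = s * t\<^sup>2 * (of_int p)\<^sup>2"
      using det e(1,2) by algebra
    moreover have "?z = - (s * t\<^sup>2 * (of_int q)\<^sup>2)"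
      using det e(3,4) by algebra
    moreover have "?y \<in> \<int>" "?z \<in> \<int>"
      using \<gamma> by (auto simp: SL2Z_def)
    ultimately have pq: "s * t\<^sup>2 * (of_int p)\<^sup>2 \<in> \<int>" "s * t\<^sup>2 * (of_int q)\<^sup>2 \<in> \<int>"
      by (auto simp: minus_in_Ints_iff)
    \<comment> \<open>A Bezout relation for the squares recovers \<open>s t\<^sup>2\<close> from the two off-diagonal entries.\<close>
    have "coprime (p\<^sup>2) (q\<^sup>2)"
      using cop by simp
    then obtain m n where "m * p\<^sup>2 + n * q\<^sup>2 = 1"
      by (metis bezout_int coprime_iff_gcd_eq_1)
    then have "of_int m * (of_int p)\<^sup>2 + of_int n * (of_int q)\<^sup>2 = (1::real)"
      by (metis of_int_1 of_int_add of_int_mult of_int_power)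
    then have "s * t\<^sup>2 = of_int m * (s * t\<^sup>2 * (of_int p)\<^sup>2) + of_int n * (s * t\<^sup>2 * (of_int q)\<^sup>2)"
      by algebra
    also have "\<dots> \<in> \<int>"
      by (intro Ints_add Ints_mult pq) auto
    finally show "s * t\<^sup>2 \<in> \<int>" .
  next
    assume st: "s * t\<^sup>2 \<in> \<int>"
    define r where "r = s * t\<^sup>2"
    define P Q :: real where "P = of_int p" and "Q = of_int q"
    have int: "r \<in> \<int>" "P \<in> \<int>" "Q \<in> \<int>"
      using st by (simp_all add: r_def P_def Q_def)
    have det: "t * P * d - b * (t * Q) = 1"
      using det by (simp add: P_def Q_def)
    define \<gamma> :: "real^2^2"
      where "\<gamma> = vector [vector [1 - r * P * Q, r * P\<^sup>2], vector [- (r * Q\<^sup>2), 1 + r * P * Q]]"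
    have "\<gamma> \<in> SL2Z"
      using int by (auto simp: SL2Z_def SL2R_def det_2 \<gamma>_def forall_2 algebra_simps power2_eq_square
          intro!: Ints_add Ints_mult Ints_diff Ints_minus)
    moreover have "(1 - r * P * Q) * b + r * P\<^sup>2 * d = t * P * s + b"
      "- (r * Q\<^sup>2) * b + (1 + r * P * Q) * d = t * Q * s + d"
      using det unfolding r_def by algebra+
    then have "\<gamma> ** g = g ** unip s"
      by (simp add: entrywise_2 unip_def a c \<gamma>_def flip: b_def d_def P_def Q_def)
        (simp add: algebra_simps power2_eq_square)
    ultimately show "\<exists>\<gamma>\<in>SL2Z. \<gamma> ** g = g ** unip s" by blast
  qed
qed

lemma horocycle_period_scaled_primitive:
  assumes "g \<in> SL2R" "column 1 g = t *\<^sub>R vector [of_int p, of_int q]"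
    and "coprime p q" "t \<noteq> 0"
  shows "horocycle_period g = 1 / t\<^sup>2"
  unfolding horocycle_period_def conjugate_unip_in_SL2Z_iff[OF assms(1-3)]
proof (rule Least_equality)
  show "0 < 1 / t\<^sup>2 \<and> 1 / t\<^sup>2 * t\<^sup>2 \<in> \<int>"
    using assms(4) by simp
next
  fix s :: real
  assume s: "s > 0 \<and> s * t\<^sup>2 \<in> \<int>"
  then obtain k where k: "s * t\<^sup>2 = of_int k" by (auto elim: Ints_cases)
  moreover have "s * t\<^sup>2 > 0" using s assms(4) by simp
  ultimately have "s * t\<^sup>2 \<ge> 1" by simp
  then show "1 / t\<^sup>2 \<le> s"
    using assms(4) by (simp add: divide_le_eq)
qed

lemma ex_SL2R_column_1:
  fixes w :: "real^2"
  assumes "w \<noteq> 0"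
  shows "\<exists>g\<in>SL2R. column 1 g = w"
proof
  define n where "n = (w$1)\<^sup>2 + (w$2)\<^sup>2"
  have n: "n \<noteq> 0"
    using assms by (simp add: n_def entrywise_2 sum_power2_eq_zero_iff)
  let ?g = "vector [vector [w$1, - w$2 / n], vector [w$2, w$1 / n]] :: real^2^2"
  show "?g \<in> SL2R"
    using n by (simp add: SL2R_def det_2 field_simps) (simp add: n_def power2_eq_square)
  show "column 1 ?g = w"
    by (simp add: entrywise_2)
qed

lemma period_scaled_primitive:
  assumes "w = t *\<^sub>R vector [of_int p, of_int q]" "coprime p q" "t \<noteq> 0" "w \<noteq> 0"
  shows "period w = 1 / t\<^sup>2"
  unfolding period_def
proof (rule the_equality)
  show *: "\<forall>g\<in>SL2R. column 1 g = w \<longrightarrow> horocycle_period g = 1 / t\<^sup>2"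
    using horocycle_period_scaled_primitive assms by blast
  fix \<rho> assume "\<forall>g\<in>SL2R. column 1 g = w \<longrightarrow> horocycle_period g = \<rho>"
  then show "\<rho> = 1 / t\<^sup>2"
    using ex_SL2R_column_1[OF assms(4)] * by auto
qed

text \<open>The image stays primitive because the inverse of \<open>\<gamma>\<close> is integral: multiplying a Bezout
  row \<open>(m, n)\<close> for \<open>(p, q)\<close> by it on the right gives a Bezout row for the image.\<close>

lemma SL2Z_scaled_primitive:
  assumes "\<gamma> \<in> SL2Z" "coprime p q"
  obtains p' q' where "coprime p' q'"
    "\<gamma> *v (t *\<^sub>R vector [of_int p, of_int q]) = t *\<^sub>R vector [of_int p', of_int q']"
proof -
  have "\<gamma>$1$1 \<in> \<int>" "\<gamma>$1$2 \<in> \<int>" "\<gamma>$2$1 \<in> \<int>" "\<gamma>$2$2 \<in> \<int>"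
    using assms by (auto simp: SL2Z_def)
  then obtain x y z k where e: "\<gamma>$1$1 = of_int x" "\<gamma>$1$2 = of_int y" "\<gamma>$2$1 = of_int z"
      "\<gamma>$2$2 = of_int k"
    by (elim Ints_cases)
  have "of_int (x * k - y * z) = (1::real)"
    using assms e by (simp add: SL2Z_def SL2R_def det_2)
  then have det: "x * k - y * z = 1"
    by linarith
  obtain m n where mn: "m * p + n * q = 1"
    using assms(2) by (metis bezout_int coprime_iff_gcd_eq_1)
  have "(m * k - n * z) * (x * p + y * q) + (n * x - m * y) * (z * p + k * q) = 1"
    using det mn by algebra
  then have "coprime (x * p + y * q) (z * p + k * q)"
    by (metis coprimeI dvd_add dvd_mult)
  moreover have "\<gamma> *v (t *\<^sub>R vector [of_int p, of_int q])
      = t *\<^sub>R vector [of_int (x * p + y * q), of_int (z * p + k * q)]"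
    by (simp add: entrywise_2 e algebra_simps)
  ultimately show thesis by (rule that)
qed

lemma SL2Z_mult_period_points:
  assumes "\<gamma> \<in> SL2Z" "w \<in> period_points \<rho>"
  shows "\<gamma> *v w \<in> period_points \<rho>"
proof -
  have w: "w \<noteq> 0" "rational_slope w" "period w = \<rho>"
    using assms by (auto simp: period_points_def)
  then obtain t p q where t: "t \<noteq> 0" "coprime p q" "w = t *\<^sub>R vector [of_int p, of_int q]"
    by (auto simp: rational_slope_iff_scaled_primitive)
  obtain p' q' where pq': "coprime p' q'" "\<gamma> *v w = t *\<^sub>R vector [of_int p', of_int q']"
    using SL2Z_scaled_primitive[OF assms(1) t(2)] t(3) by metis
  have "vector [of_int p', of_int q'] \<noteq> (0 :: real^2)"
    using pq'(1) by (auto simp: entrywise_2)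
  then have nz: "\<gamma> *v w \<noteq> 0"
    using t(1) pq'(2) by simp
  then have "period (\<gamma> *v w) = period w"
    using period_scaled_primitive t pq' w(1) by metis
  moreover have "rational_slope (\<gamma> *v w)"
    using nz t(1) pq' by (auto simp: rational_slope_iff_scaled_primitive)
  ultimately show ?thesis
    using nz w(3) by (simp add: period_points_def)
qed

lemma norm_scaled_integer_vector:
  "norm (t *\<^sub>R vector [of_int p, of_int q] :: real^2) = \<bar>t\<bar> * sqrt ((of_int p)\<^sup>2 + (of_int q)\<^sup>2)"
  by (simp add: norm_vec_def L2_set_def sum_2 power_mult_distrib real_sqrt_mult flip: distrib_left)

text \<open>The height is well defined because the period determines \<open>\<bar>t\<bar>\<close>, and \<open>\<bar>t\<bar>\<close> and \<open>norm w\<close>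
  determine the length of the primitive vector.\<close>

lemma slope_height_scaled_primitive:
  assumes "w = t *\<^sub>R vector [of_int p, of_int q]" "coprime p q" "t \<noteq> 0" "w \<noteq> 0"
  shows "slope_height w = sqrt ((of_int p)\<^sup>2 + (of_int q)\<^sup>2)"
  unfolding slope_height_def
proof (rule the_equality)
  show "\<exists>(t::real) (p'::int) (q'::int). t \<noteq> 0 \<and> coprime p' q' \<and>
      w = t *\<^sub>R vector [of_int p', of_int q'] \<and>
      sqrt ((of_int p)\<^sup>2 + (of_int q)\<^sup>2) = sqrt ((of_int p')\<^sup>2 + (of_int q')\<^sup>2)"
    using assms by blast
next
  fix h
  assume "\<exists>(t::real) (p::int) (q::int). t \<noteq> 0 \<and> coprime p q \<and>
      w = t *\<^sub>R vector [of_int p, of_int q] \<and> h = sqrt ((of_int p)\<^sup>2 + (of_int q)\<^sup>2)"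
  then obtain t' p' q' where *: "t' \<noteq> 0" "coprime p' q'"
    "w = t' *\<^sub>R vector [of_int p', of_int q']" "h = sqrt ((of_int p')\<^sup>2 + (of_int q')\<^sup>2)"
    by blast
  have "1 / t'\<^sup>2 = 1 / t\<^sup>2"
    using period_scaled_primitive[OF assms] period_scaled_primitive[OF *(3,2,1) assms(4)] by simp
  then have "\<bar>t'\<bar> = \<bar>t\<bar>"
    by (simp add: power2_eq_iff abs_eq_iff)
  moreover have "\<bar>t'\<bar> * h = \<bar>t\<bar> * sqrt ((of_int p)\<^sup>2 + (of_int q)\<^sup>2)"
    using assms(1) *(3,4) norm_scaled_integer_vector by metis
  ultimately show "h = sqrt ((of_int p)\<^sup>2 + (of_int q)\<^sup>2)"
    using assms(3) by simp
qed

lemma period_eq_height_over_norm: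
  assumes "w \<noteq> 0" "rational_slope w"
  shows "period w = (slope_height w)\<^sup>2 / (norm w)\<^sup>2"
proof -
  obtain t p q where t: "t \<noteq> 0" "coprime p q" "w = t *\<^sub>R vector [of_int p, of_int q]"
    using assms by (auto simp: rational_slope_iff_scaled_primitive)
  have h: "slope_height w = sqrt ((of_int p)\<^sup>2 + (of_int q)\<^sup>2)"
    using slope_height_scaled_primitive t assms(1) by blast
  then have n: "norm w = \<bar>t\<bar> * slope_height w"
    using t(3) norm_scaled_integer_vector by metis
  then have "slope_height w \<noteq> 0"
    using assms(1) by auto
  then show ?thesis
    using period_scaled_primitive[OF t(3,2,1) assms(1)] n by (simp add: power_mult_distrib)
qed

theorem proposition4:
  fixes v w :: "real^2" and T :: real
  assumes "v \<noteq> 0" and "irrational_slope v"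
    and "T > 0"
    and "w \<noteq> 0" and "rational_slope w"
  shows "(\<forall>\<gamma>\<in>Gamma_ball T. norm (\<gamma> *v v - w) \<ge> period_spectrum v (period w) / T) \<and>
    period_spectrum v (period w) / T
      = period_spectrum v ((slope_height w)\<^sup>2 / (norm w)\<^sup>2) / T"
proof (intro conjI ballI)
  fix \<gamma> assume "\<gamma> \<in> Gamma_ball T"
  then have \<gamma>: "\<gamma> \<in> SL2Z" "norm \<gamma> \<le> T"
    by (auto simp: Gamma_ball_def)
  obtain \<delta> where \<delta>: "\<delta> \<in> SL2Z" "\<delta> ** \<gamma> = mat 1" "norm \<delta> = norm \<gamma>"
    using SL2Z_inverse_same_norm[OF \<gamma>(1)] .
  have "w \<in> period_points (period w)"
    using assms by (simp add: period_points_def)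
  then have "\<delta> *v w \<in> period_points (period w)"
    using SL2Z_mult_period_points \<delta>(1) by blast
  then have "period_spectrum v (period w) \<le> dist v (\<delta> *v w)"
    unfolding period_spectrum_def by (rule infdist_le)
  also have "\<dots> = norm (\<delta> *v (\<gamma> *v v - w))"
    using \<delta>(2) by (simp add: dist_norm matrix_vector_mult_diff_distrib matrix_vector_mul_assoc)
  also have "\<dots> \<le> norm \<delta> * norm (\<gamma> *v v - w)"
    by (rule norm_matrix_vector_mult_le)
  also have "\<dots> \<le> T * norm (\<gamma> *v v - w)"
    using \<gamma>(2) \<delta>(3) by (simp add: mult_right_mono)
  finally show "period_spectrum v (period w) / T \<le> norm (\<gamma> *v v - w)"
    using assms(3) by (simp add: divide_le_eq mult.commute)
next
  show "period_spectrum v (period w) / T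
      = period_spectrum v ((slope_height w)\<^sup>2 / (norm w)\<^sup>2) / T"
    using period_eq_height_over_norm assms by simp
qed

end
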